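(* Let $\mathcal{A}$ be a coset S-ring over a finite cyclic group. Then $\mathcal{A}$ is schurian and separable.
   Context: An S-ring over a finite group $G$ is a subring $\mathcal{A}$ of the group ring $\mathbb{Z}G$ for which there is a partition $\mathcal{S}(\mathcal{A})$ of $G$ (its classes are called basic sets) such that $\{1_G\}\in\mathcal{S}(\mathcal{A})$; $X\in\mathcal{S}(\mathcal{A})$ implies $X^{-1}\in\mathcal{S}(\mathcal{A})$; and $\mathcal{A}$ is the $\mathbb{Z}$-span of the elements $\sum_{x\in X}x$, $X\in\mathcal{S}(\mathcal{A})$. It is circulant if $G$ is cyclic. A coset S-ring over an abelian group $G$ is an S-ring each basic set of which is a coset of a subgroup of $G$. Let $G_{right}\le\mathrm{Sym}(G)$ be the group of right multiplications. An S-ring $\mathcal{A}$ over $G$ is schurian if there is a group $\Gamma$ with $G_{right}\le\Gamma\le\mathrm{Sym}(G)$ such that $\mathcal{S}(\mathcal{A})$ is the set of orbits on $G$ of the stabilizer of $1_G$ in $\Gamma$. A similarity from an S-ring $\mathcal{A}$ over $G$ to an S-ring $\mathcal{A}'$ over $G'$ is a ring isomorphism $\varphi:\mathcal{A}\to\mathcal{A}'$ such that for every $X\in\mathcal{S}(\mathcal{A})$ there is $X^\varphi\in\mathcal{S}(\mathcal{A}')$ with $\varphi(\sum_{x\in X}x)=\sum_{x'\in X^\varphi}x'$. A bijection $f:G\to G'$ is an isomorphism inducing $\varphi$ if $f(Xy)=X^\varphi f(y)$ for all $X\in\mathcal{S}(\mathcal{A})$ and $y\in G$. A circulant S-ring $\mathcal{A}$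 is separable if every similarity from $\mathcal{A}$ to any circulant S-ring $\mathcal{A}'$ is induced by some isomorphism. *)

theory Defs
  imports "HOL-Algebra.Elementary_Groups" "HOL-Algebra.Group_Action" "HOL-Algebra.QuotRing"
    "HOL-Algebra.Subrings" "HOL-Library.Disjoint_Sets"
begin

text \<open>
  The integral group ring \<open>\<int>G\<close> of a finite group. The element \<open>\<Sum>x. a x \<cdot> x\<close> is represented by its
  coefficient function \<open>a\<close>, which vanishes outside the carrier of \<open>G\<close>.
\<close>

definition group_ring :: "('a, 'm) monoid_scheme \<Rightarrow> ('a \<Rightarrow> int) ring" where
  "group_ring G =
    \<lparr>carrier = {a. \<forall>x. x \<notin> carrier G \<longrightarrow> a x = 0},
     monoid.mult = (\<lambda>a b x. \<Sum>(y, z) \<in> {(y, z). y \<in> carrier G \<and> z \<in> carrier G \<and> y \<otimes>\<^bsub>G\<^esub> z = x}. a y * b z),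
     one = (\<lambda>x. of_bool (x = \<one>\<^bsub>G\<^esub>)),
     ring.zero = (\<lambda>_. 0),
     ring.add = (\<lambda>a b x. a x + b x)\<rparr>"

text \<open>The element \<open>\<Sum>x\<in>X. x\<close> of the group ring.\<close>

definition set_elem :: "'a set \<Rightarrow> 'a \<Rightarrow> int" where
  "set_elem X = (\<lambda>x. of_bool (x \<in> X))"

text \<open>\<open>S\<close> is a partition witnessing that \<open>A\<close> is an S-ring; the last conjunct says that \<open>A\<close> is the
  \<open>\<int>\<close>-span of the elements \<open>\<Sum>x\<in>X. x\<close>, \<open>X \<in> S\<close>.\<close>

definition basic_partition :: "('a, 'm) monoid_scheme \<Rightarrow> ('a \<Rightarrow> int) set \<Rightarrow> 'a set set \<Rightarrow> bool" where
  "basic_partition G A S \<longleftrightarrow>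
     partition_on (carrier G) S \<and>
     {\<one>\<^bsub>G\<^esub>} \<in> S \<and>
     (\<forall>X\<in>S. set_inv\<^bsub>G\<^esub> X \<in> S) \<and>
     A = {(\<lambda>x. \<Sum>X\<in>S. c X * set_elem X x) | c. True}"

definition S_ring :: "('a, 'm) monoid_scheme \<Rightarrow> ('a \<Rightarrow> int) set \<Rightarrow> bool" where
  "S_ring G A \<longleftrightarrow>
     group G \<and> finite (carrier G) \<and> subring A (group_ring G) \<and> (\<exists>S. basic_partition G A S)"

text \<open>The partition is determined by \<open>A\<close>; see \<open>basic_partition_unique\<close> below.\<close>

definition basic_sets :: "('a, 'm) monoid_scheme \<Rightarrow> ('a \<Rightarrow> int) set \<Rightarrow> 'a set set" where
  "basic_sets G A = (THE S. basic_partition G A S)"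

definition circulant_S_ring :: "('a, 'm) monoid_scheme \<Rightarrow> ('a \<Rightarrow> int) set \<Rightarrow> bool" where
  "circulant_S_ring G A \<longleftrightarrow> S_ring G A \<and> cyclic_group G"

definition coset_S_ring :: "('a, 'm) monoid_scheme \<Rightarrow> ('a \<Rightarrow> int) set \<Rightarrow> bool" where
  "coset_S_ring G A \<longleftrightarrow>
     comm_group G \<and> S_ring G A \<and>
     (\<forall>X\<in>basic_sets G A. \<exists>H. subgroup H G \<and> X \<in> rcosets\<^bsub>G\<^esub> H)"

definition right_mults :: "('a, 'm) monoid_scheme \<Rightarrow> ('a \<Rightarrow> 'a) set" where
  "right_mults G = {(\<lambda>x\<in>carrier G. x \<otimes>\<^bsub>G\<^esub> g) | g. g \<in> carrier G}"

text \<open>\<open>BijGroup (carrier G)\<close> is \<open>Sym(G)\<close>, and \<open>\<lambda>f. f\<close> is its natural action on \<open>G\<close>.\<close>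

definition schurian :: "('a, 'm) monoid_scheme \<Rightarrow> ('a \<Rightarrow> int) set \<Rightarrow> bool" where
  "schurian G A \<longleftrightarrow>
     (\<exists>\<Gamma>. subgroup \<Gamma> (BijGroup (carrier G)) \<and> right_mults G \<subseteq> \<Gamma> \<and>
        (let P = (BijGroup (carrier G))\<lparr>carrier := \<Gamma>\<rparr> in
           basic_sets G A =
             orbits (P\<lparr>carrier := stabilizer P (\<lambda>f. f) \<one>\<^bsub>G\<^esub>\<rparr>) (carrier G) (\<lambda>f. f)))"

definition similarity ::
  "('a, 'm) monoid_scheme \<Rightarrow> ('a \<Rightarrow> int) set \<Rightarrow> ('b, 'n) monoid_scheme \<Rightarrow> ('b \<Rightarrow> int) set \<Rightarrow>
   (('a \<Rightarrow> int) \<Rightarrow> ('b \<Rightarrow> int)) \<Rightarrow> bool" where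
  "similarity G A G' A' \<phi> \<longleftrightarrow>
     \<phi> \<in> ring_iso ((group_ring G)\<lparr>carrier := A\<rparr>) ((group_ring G')\<lparr>carrier := A'\<rparr>) \<and>
     (\<forall>X\<in>basic_sets G A. \<exists>X'\<in>basic_sets G' A'. \<phi> (set_elem X) = set_elem X')"

text \<open>The set \<open>X'\<close> below is the image of \<open>X\<close> under the similarity; it is unique since \<open>set_elem\<close> is
  injective.\<close>

definition induces ::
  "('a, 'm) monoid_scheme \<Rightarrow> ('a \<Rightarrow> int) set \<Rightarrow> ('b, 'n) monoid_scheme \<Rightarrow> ('b \<Rightarrow> int) set \<Rightarrow>
   ('a \<Rightarrow> 'b) \<Rightarrow> (('a \<Rightarrow> int) \<Rightarrow> ('b \<Rightarrow> int)) \<Rightarrow> bool" where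
  "induces G A G' A' f \<phi> \<longleftrightarrow>
     bij_betw f (carrier G) (carrier G') \<and>
     (\<forall>X\<in>basic_sets G A. \<exists>X'\<in>basic_sets G' A'. \<phi> (set_elem X) = set_elem X' \<and>
        (\<forall>y\<in>carrier G. f ` (X #>\<^bsub>G\<^esub> y) = X' #>\<^bsub>G'\<^esub> f y))"

text \<open>HOL formulas cannot quantify over types, so the type of the elements of the target group is a
  parameter. A statement about \<open>separable TYPE('b)\<close> with \<open>'b\<close> a type variable covers all finite
  cyclic target groups, on whatever type.\<close>

definition separable ::
  "'b itself \<Rightarrow> ('a, 'm) monoid_scheme \<Rightarrow> ('a \<Rightarrow> int) set \<Rightarrow> bool" where
  "separable _ G A \<longleftrightarrow>
     circulant_S_ring G A \<and>
     (\<forall>(G' :: 'b monoid) A' \<phi>. circulant_S_ring G' A' \<and> similarity G A G' A' \<phi> \<longrightarrow>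
        (\<exists>f. induces G A G' A' f \<phi>))"


lemma basic_partition_same_class:
  assumes "finite (carrier G)" "basic_partition G A S" "x \<in> carrier G" "y \<in> carrier G" "X \<in> S" "x \<in> X"
  shows "y \<in> X \<longleftrightarrow> (\<forall>a\<in>A. a x = a y)"
proof -
  have part: "partition_on (carrier G) S"
    and A: "A = {(\<lambda>x. \<Sum>X\<in>S. c X * set_elem X x) | c. True}"
    using assms(2) by (auto simp: basic_partition_def)
  have finS: "finite S"
    using part assms(1) by (simp add: finite_elements)
  have uniq: "(z \<in> Y) = (Y = Z)" if "z \<in> Z" "Z \<in> S" "Y \<in> S" for z Y Z
    using part that by (auto simp: partition_on_def disjoint_def)
  have val: "(\<Sum>Y\<in>S. c Y * set_elem Y z) = c Z" if "z \<in> Z" "Z \<in> S" for c z Z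
  proof -
    have "(\<Sum>Y\<in>S. c Y * set_elem Y z) = (\<Sum>Y\<in>S. if Y = Z then c Y else 0)"
      by (intro sum.cong) (auto simp: set_elem_def uniq[OF that])
    then show ?thesis using finS that by simp
  qed
  obtain Y where Y: "Y \<in> S" "y \<in> Y"
    using part assms(4) by (auto simp: partition_on_def)
  show ?thesis
  proof
    assume "y \<in> X"
    then show "\<forall>a\<in>A. a x = a y"
      using val[OF \<open>x \<in> X\<close> \<open>X \<in> S\<close>] val[OF \<open>y \<in> X\<close> \<open>X \<in> S\<close>] by (auto simp: A)
  next
    assume *: "\<forall>a\<in>A. a x = a y"
    have "(\<lambda>z. \<Sum>Y\<in>S. of_bool (Y = X) * set_elem Y z) \<in> A"
      unfolding A by (rule CollectI, rule exI, rule conjI[OF refl TrueI])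
    then have "(\<Sum>Y\<in>S. of_bool (Y = X) * set_elem Y x) = (\<Sum>Y\<in>S. of_bool (Y = X) * set_elem Y y)"
      by (rule bspec[OF *])
    then have "(of_bool (X = X) :: int) = of_bool (Y = X)"
      unfolding val[OF \<open>x \<in> X\<close> \<open>X \<in> S\<close>] val[OF Y(2) Y(1)] .
    then show "y \<in> X" using Y by (cases "Y = X") auto
  qed
qed

lemma basic_partition_unique:
  assumes fin: "finite (carrier G)" and S: "basic_partition G A S" and T: "basic_partition G A T"
  shows "S = T"
proof -
  have "P \<subseteq> Q" if P: "basic_partition G A P" and Q: "basic_partition G A Q" for P Q
  proof
    fix X assume "X \<in> P"
    have pP: "partition_on (carrier G) P" and pQ: "partition_on (carrier G) Q"
      using P Q by (auto simp: basic_partition_def)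
    have "X \<noteq> {}" and "X \<subseteq> carrier G"
      using pP \<open>X \<in> P\<close> by (auto simp: partition_on_def)
    then obtain x where x: "x \<in> X" "x \<in> carrier G" by blast
    then obtain Y where Y: "Y \<in> Q" "x \<in> Y"
      using pQ by (auto simp: partition_on_def)
    have "Y \<subseteq> carrier G" using pQ Y by (auto simp: partition_on_def)
    have "y \<in> X \<longleftrightarrow> y \<in> Y" if "y \<in> carrier G" for y
      using basic_partition_same_class[OF fin P x(2) that \<open>X \<in> P\<close> x(1)]
            basic_partition_same_class[OF fin Q x(2) that Y] by simp
    then have "X = Y" using \<open>X \<subseteq> carrier G\<close> \<open>Y \<subseteq> carrier G\<close> by blast
    then show "X \<in> Q" using Y by simp
  qed
  then show ?thesis using S T by blast
qed

lemma basic_partition_basic_sets: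
  assumes "S_ring G A"
  shows "basic_partition G A (basic_sets G A)"
  unfolding basic_sets_def
  by (rule theI') (use assms basic_partition_unique in \<open>force simp: S_ring_def\<close>)

lemma group_ring_mult:
  assumes "group G" "x \<in> carrier G"
  shows "(a \<otimes>\<^bsub>group_ring G\<^esub> b) x = (\<Sum>y\<in>carrier G. a y * b (inv\<^bsub>G\<^esub> y \<otimes>\<^bsub>G\<^esub> x))"
proof -
  interpret group G by fact
  show ?thesis
    unfolding group_ring_def
    by simp (rule sum.reindex_bij_witness[of _ "\<lambda>y. (y, inv\<^bsub>G\<^esub> y \<otimes>\<^bsub>G\<^esub> x)" fst],
        auto simp: assms inv_solve_left' m_assoc[symmetric])
qed

lemma ring_group_ring:
  fixes G (structure)
  assumes "group G" "finite (carrier G)"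
  shows "ring (group_ring G)"
proof -
  interpret group G by fact
  let ?R = "group_ring G"
  have out: "(a \<otimes>\<^bsub>?R\<^esub> b) x = 0" if "x \<notin> carrier G" for a b x
    using that by (auto simp: group_ring_def intro!: sum.neutral)
  note m = group_ring_mult[OF assms(1)]
  show ?thesis
  proof (rule ringI)
    show "abelian_group ?R"
    proof (rule abelian_groupI)
      fix a assume "a \<in> carrier ?R"
      then show "\<exists>b\<in>carrier ?R. b \<oplus>\<^bsub>?R\<^esub> a = \<zero>\<^bsub>?R\<^esub>"
        by (intro bexI[of _ "\<lambda>x. - a x"]) (auto simp: group_ring_def)
    qed (auto simp: group_ring_def)
    show "monoid ?R"
    proof (rule monoidI)
      fix a b assume "a \<in> carrier ?R" "b \<in> carrier ?R"
      show "a \<otimes>\<^bsub>?R\<^esub> b \<in> carrier ?R"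
        using out[of _ a b] by (subst group_ring_def) simp
    next
      show "\<one>\<^bsub>?R\<^esub> \<in> carrier ?R" by (auto simp: group_ring_def)
    next
      fix a b c assume "a \<in> carrier ?R" "b \<in> carrier ?R" "c \<in> carrier ?R"
      show "a \<otimes>\<^bsub>?R\<^esub> b \<otimes>\<^bsub>?R\<^esub> c = a \<otimes>\<^bsub>?R\<^esub> (b \<otimes>\<^bsub>?R\<^esub> c)"
      proof
        fix x
        show "(a \<otimes>\<^bsub>?R\<^esub> b \<otimes>\<^bsub>?R\<^esub> c) x = (a \<otimes>\<^bsub>?R\<^esub> (b \<otimes>\<^bsub>?R\<^esub> c)) x"
        proof (cases "x \<in> carrier G")
          case True
          have "(a \<otimes>\<^bsub>?R\<^esub> b \<otimes>\<^bsub>?R\<^esub> c) x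
              = (\<Sum>y\<in>carrier G. \<Sum>z\<in>carrier G. a z * b (inv z \<otimes> y) * c (inv y \<otimes> x))"
            using True by (simp add: m sum_distrib_right)
          also have "\<dots> = (\<Sum>z\<in>carrier G. \<Sum>y\<in>carrier G. a z * b (inv z \<otimes> y) * c (inv y \<otimes> x))"
            by (rule sum.swap)
          also have "\<dots> = (\<Sum>z\<in>carrier G. \<Sum>y\<in>carrier G. a z * b y * c (inv y \<otimes> (inv z \<otimes> x)))"
          proof (rule sum.cong[OF refl])
            fix z assume z: "z \<in> carrier G"
            have [simp]: "inv y \<otimes> z \<otimes> inv z = inv y" if "y \<in> carrier G" for y
              using that z by (simp add: m_assoc)
            show "(\<Sum>y\<in>carrier G. a z * b (inv z \<otimes> y) * c (inv y \<otimes> x))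
                = (\<Sum>y\<in>carrier G. a z * b y * c (inv y \<otimes> (inv z \<otimes> x)))"
              by (rule sum.reindex_bij_witness[of _ "\<lambda>y. z \<otimes> y" "\<lambda>y. inv z \<otimes> y"])
                (use z True in \<open>auto simp: m_assoc[symmetric] inv_mult_group\<close>)
          qed
          also have "\<dots> = (a \<otimes>\<^bsub>?R\<^esub> (b \<otimes>\<^bsub>?R\<^esub> c)) x"
            using True by (simp add: m sum_distrib_left mult.assoc)
          finally show ?thesis .
        qed (simp add: out)
      qed
    next
      fix a assume a: "a \<in> carrier ?R"
      have a0: "a x = 0" if "x \<notin> carrier G" for x
        using a that by (auto simp: group_ring_def)
      have one: "\<one>\<^bsub>?R\<^esub> x = (if x = \<one> then 1 else 0)" for x
        by (simp add: group_ring_def)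
      show "\<one>\<^bsub>?R\<^esub> \<otimes>\<^bsub>?R\<^esub> a = a"
      proof
        fix x show "(\<one>\<^bsub>?R\<^esub> \<otimes>\<^bsub>?R\<^esub> a) x = a x"
          by (cases "x \<in> carrier G")
            (simp_all add: m one out a0 if_distrib[of "\<lambda>u. u * _"] assms(2) cong: if_cong)
      qed
      show "a \<otimes>\<^bsub>?R\<^esub> \<one>\<^bsub>?R\<^esub> = a"
      proof
        fix x show "(a \<otimes>\<^bsub>?R\<^esub> \<one>\<^bsub>?R\<^esub>) x = a x"
        proof (cases "x \<in> carrier G")
          case True
          then have "inv y \<otimes> x = \<one> \<longleftrightarrow> y = x" if "y \<in> carrier G" for y
            using that by (metis inv_closed inv_equality inv_inv l_inv)
          then have "(a \<otimes>\<^bsub>?R\<^esub> \<one>\<^bsub>?R\<^esub>) x = (\<Sum>y\<in>carrier G. if y = x then a y else 0)"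
            using True by (simp add: m one) (rule sum.cong, auto)
          then show ?thesis using True assms(2) by simp
        qed (simp add: out a0)
      qed
    qed
    fix a b c assume "a \<in> carrier ?R" "b \<in> carrier ?R" "c \<in> carrier ?R"
    show "(a \<oplus>\<^bsub>?R\<^esub> b) \<otimes>\<^bsub>?R\<^esub> c = a \<otimes>\<^bsub>?R\<^esub> c \<oplus>\<^bsub>?R\<^esub> b \<otimes>\<^bsub>?R\<^esub> c"
      "c \<otimes>\<^bsub>?R\<^esub> (a \<oplus>\<^bsub>?R\<^esub> b) = c \<otimes>\<^bsub>?R\<^esub> a \<oplus>\<^bsub>?R\<^esub> c \<otimes>\<^bsub>?R\<^esub> b"
      by (auto simp: group_ring_def fun_eq_iff algebra_simps sum.distrib case_prod_unfold)
  qed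
qed

end

theory Submission
  imports Defs
begin

text \<open>Write \<open>C z\<close> for the image, under a similarity \<open>\<phi>\<close> from \<open>A\<close> to \<open>A'\<close>, of the basic set containing \<open>z\<close>.
  A map \<open>f\<close> induces \<open>\<phi>\<close> as soon as all its differences satisfy \<open>f x \<cdot> (f y)\<^sup>-\<^sup>1 \<in> C (x \<cdot> y\<^sup>-\<^sup>1)\<close>, for then
  \<open>f (X y) \<subseteq> X\<^sup>\<phi> f y\<close>, and counting turns the inclusion into equality. Such a map is built one
  point at a time. To add a point \<open>x\<close> to a domain \<open>S\<close> one needs a value in all the sets \<open>C (x \<cdot> y\<^sup>-\<^sup>1) f y\<close>,
  \<open>y \<in> S\<close>. Three observations make this possible:

  \<^item> These sets are cosets of subgroups. A basic set \<open>X\<close> is a coset iff the support of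
    \<open>X \<cdot> X\<^sup>-\<^sup>1 \<cdot> X\<close> is \<open>X\<close>, and \<open>\<phi>\<close> transports supports of products, so \<open>X\<^sup>\<phi>\<close> is a coset too
    (\<open>image_class_affine\<close>).
  \<^item> They meet pairwise: the support of a product of basic sets is a union of basic sets, which gives
    \<open>C (z \<cdot> w) \<subseteq> C z \<cdot> C w\<close> (\<open>image_class_mult\<close>), and this makes any two of the conditions on the new
    value compatible.
  \<^item> Cosets in a cyclic group have the Helly property: if they meet pairwise, they have a common point
    (\<open>cyclic_affine_Helly\<close>). This is a form of the Chinese remainder theorem, and the only place
    where cyclicity enters.

  For separability the construction starts with \<open>1 \<mapsto> 1\<close>. For schurity one takes for \<open>\<phi>\<close> the
  identity, so that \<open>C z\<close> is the basic set of \<open>z\<close>, and prescribes in addition \<open>x \<mapsto> y\<close> for two given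
  elements \<open>x\<close>, \<open>y\<close> of one basic set: the extension is an automorphism fixing \<open>1\<close> and taking \<open>x\<close>
  to \<open>y\<close>. Hence the stabilizer of \<open>1\<close> in the group of all automorphisms is transitive on each
  basic set.\<close>

section \<open>The Helly property of cosets in a cyclic group\<close>

lemma affine_int_closed:
  fixes P :: "int set"
  assumes P: "\<And>x y z. x \<in> P \<Longrightarrow> y \<in> P \<Longrightarrow> z \<in> P \<Longrightarrow> x - y + z \<in> P"
    and "x \<in> P" "y \<in> P"
  shows "x + k * (y - x) \<in> P"
proof (induction k rule: int_induct[where k = 0])
  case (step1 i)
  show ?case using P[OF step1(2) assms(2,3)] by (simp add: algebra_simps)
next
  case (step2 i)
  show ?case using P[OF step2(2) assms(3,2)] by (simp add: algebra_simps)
qed (simp add: assms)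

text \<open>Pick a point in each pairwise intersection. The three points differ by
  \<open>g \<cdot> a\<close>, \<open>g \<cdot> b\<close> and \<open>g \<cdot> (a + b)\<close> with \<open>a\<close>, \<open>b\<close> coprime, and \<open>P\<close>, \<open>Q\<close>, \<open>R\<close> are closed under steps of
  these respective lengths, so a solution of a system of three congruences lies in all of them;
  Bezout's identity writes one down.\<close>

lemma affine_int_triple:
  fixes P Q R :: "int set"
  assumes P: "\<And>x y z. x \<in> P \<Longrightarrow> y \<in> P \<Longrightarrow> z \<in> P \<Longrightarrow> x - y + z \<in> P"
    and Q: "\<And>x y z. x \<in> Q \<Longrightarrow> y \<in> Q \<Longrightarrow> z \<in> Q \<Longrightarrow> x - y + z \<in> Q"
    and R: "\<And>x y z. x \<in> R \<Longrightarrow> y \<in> R \<Longrightarrow> z \<in> R \<Longrightarrow> x - y + z \<in> R"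
    and "P \<inter> Q \<noteq> {}" "P \<inter> R \<noteq> {}" "Q \<inter> R \<noteq> {}"
  shows "P \<inter> Q \<inter> R \<noteq> {}"
proof -
  obtain p q r where p: "p \<in> P" "p \<in> Q" and q: "q \<in> P" "q \<in> R" and r: "r \<in> Q" "r \<in> R"
    using assms(4-6) by blast
  define g where "g = gcd (p - q) (r - p)"
  show ?thesis
  proof (cases "g = 0")
    case True
    then show ?thesis using p q by (auto simp: g_def)
  next
    case False
    define a b where "a = (p - q) div g" and "b = (r - p) div g"
    have a: "p - q = g * a" and b: "r - p = g * b"
      by (simp_all add: a_def b_def g_def)
    obtain u v where "u * (p - q) + v * (r - p) = g"
      unfolding g_def using bezout_int by blast
    then have "g * (u * a + v * b) = g * 1"
      unfolding a b by (simp add: algebra_simps)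
    then have uv: "u * a + v * b = 1" using False by simp
    \<comment> \<open>Adding a multiple of \<open>g * a * b\<close> to \<open>p\<close> keeps the residues modulo \<open>g * a\<close> and \<open>g * b\<close>; the factor
      \<open>u - v\<close> solves \<open>1 + t * b \<equiv> 0\<close> modulo \<open>a + b\<close>, which yields the residue of \<open>q\<close> modulo \<open>g * (a + b)\<close>.\<close>
    define i where "i = p + (u - v) * g * a * b"
    have "i = p + ((v - u) * b) * (q - p)"
    proof -
      have "((v - u) * b) * (q - p) = ((u - v) * b) * (p - q)" by (simp add: algebra_simps)
      then show ?thesis unfolding i_def a by (simp add: algebra_simps)
    qed
    moreover have "i = p + ((u - v) * a) * (r - p)"
      unfolding b i_def by (simp add: algebra_simps)
    moreover have "i = q + (a * u) * (r - q)"
    proof -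
      have "i = q + g * a * (1 + (u - v) * b)" using a by (simp add: i_def algebra_simps)
      also have "1 + (u - v) * b = u * (a + b)" using uv by (simp add: algebra_simps)
      also have "g * a * (u * (a + b)) = (a * u) * (g * a + g * b)" by (simp add: algebra_simps)
      also have "g * a + g * b = r - q" using a b by simp
      finally show ?thesis .
    qed
    ultimately have "i \<in> P" "i \<in> Q" "i \<in> R"
      using affine_int_closed[OF P p(1) q(1)] affine_int_closed[OF Q p(2) r(1)]
        affine_int_closed[OF R q(2) r(2)] by metis+
    then show ?thesis by blast
  qed
qed

lemma affine_int_Helly:
  fixes D :: "'i \<Rightarrow> int set"
  assumes "finite I"
    and "\<And>i x y z. i \<in> I \<Longrightarrow> x \<in> D i \<Longrightarrow> y \<in> D i \<Longrightarrow> z \<in> D i \<Longrightarrow> x - y + z \<in> D i"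
    and "\<And>i j. i \<in> I \<Longrightarrow> j \<in> I \<Longrightarrow> D i \<inter> D j \<noteq> {}"
  shows "(\<Inter>i\<in>I. D i) \<noteq> {}"
  using assms
proof (induction I arbitrary: D rule: finite_induct)
  case (insert j I)
  show ?case
  proof (cases "I = {}")
    case True
    then show ?thesis using insert.prems(2)[of j j] by simp
  next
    case False
    \<comment> \<open>Cutting every set down to \<open>D j\<close> keeps the pairwise intersections nonempty, by the case of three
      sets.\<close>
    have "(\<Inter>i\<in>I. D i \<inter> D j) \<noteq> {}"
    proof (rule insert.IH)
      fix i k assume ik: "i \<in> I" "k \<in> I"
      have "D i \<inter> D k \<inter> D j \<noteq> {}"
        by (rule affine_int_triple) (use ik insert.prems in blast)+
      then show "D i \<inter> D j \<inter> (D k \<inter> D j) \<noteq> {}" by blast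
    qed (use insert.prems(1) in blast)
    then show ?thesis using False by auto
  qed
qed simp

text \<open>The nonempty affine subsets are the cosets of subgroups. Unlike a description by a subgroup and a
  representative, this closure property is visibly inherited by intersections, by translates and, read
  as a statement about the group ring, by images under similarities.\<close>

definition affine_subset :: "('a, 'm) monoid_scheme \<Rightarrow> 'a set \<Rightarrow> bool" where
  "affine_subset G C \<longleftrightarrow> C \<subseteq> carrier G \<and> (\<forall>x\<in>C. \<forall>y\<in>C. \<forall>z\<in>C. x \<otimes>\<^bsub>G\<^esub> inv\<^bsub>G\<^esub> y \<otimes>\<^bsub>G\<^esub> z \<in> C)"

lemma cyclic_affine_Helly:
  fixes G :: "('a, 'm) monoid_scheme" (structure)
  assumes "group G" "cyclic_group G" "finite I"
    and aff: "\<And>i. i \<in> I \<Longrightarrow> affine_subset G (C i)"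
    and pair: "\<And>i j. i \<in> I \<Longrightarrow> j \<in> I \<Longrightarrow> C i \<inter> C j \<noteq> {}"
  shows "\<exists>v\<in>carrier G. \<forall>i\<in>I. v \<in> C i"
proof -
  interpret group G by fact
  obtain g where g: "g \<in> carrier G" and range: "carrier G = range (\<lambda>n::int. g [^] n)"
    using \<open>cyclic_group G\<close> cyclic_group by blast
  have "(\<Inter>i\<in>I. {n::int. g [^] n \<in> C i}) \<noteq> {}"
  proof (rule affine_int_Helly[OF \<open>finite I\<close>])
    fix i and x y z :: int
    assume "i \<in> I" "x \<in> {n. g [^] n \<in> C i}" "y \<in> {n. g [^] n \<in> C i}" "z \<in> {n. g [^] n \<in> C i}"
    then have "g [^] x \<otimes> inv (g [^] y) \<otimes> g [^] z \<in> C i"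
      using aff unfolding affine_subset_def by blast
    then show "x - y + z \<in> {n. g [^] n \<in> C i}"
      using g by (simp add: int_pow_diff int_pow_mult)
  next
    fix i j assume ij: "i \<in> I" "j \<in> I"
    then obtain w where "w \<in> C i" "w \<in> C j" using pair by blast
    moreover have "w \<in> carrier G" using aff[OF ij(1)] \<open>w \<in> C i\<close> by (auto simp: affine_subset_def)
    ultimately show "{n::int. g [^] n \<in> C i} \<inter> {n. g [^] n \<in> C j} \<noteq> {}"
      using range by auto
  qed
  then show ?thesis using g by auto
qed

section \<open>Extending maps with prescribed differences\<close>

lemma (in group) mult_inv_mult_cancel:
  assumes "x \<in> carrier G" "y \<in> carrier G" "z \<in> carrier G"
  shows "(x \<otimes> inv y) \<otimes> (y \<otimes> z) = x \<otimes> z"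
proof -
  have "inv y \<otimes> (y \<otimes> z) = z" using assms by (simp add: m_assoc[symmetric])
  then show ?thesis using assms by (simp add: m_assoc)
qed

lemma (in group) translate_heap:
  assumes "s \<in> carrier G" "t \<in> carrier G" "u \<in> carrier G" "a \<in> carrier G"
  shows "(s \<otimes> a) \<otimes> inv (t \<otimes> a) \<otimes> (u \<otimes> a) = s \<otimes> inv t \<otimes> u \<otimes> a"
proof -
  have "(s \<otimes> a) \<otimes> inv (t \<otimes> a) = s \<otimes> inv t"
    using mult_inv_mult_cancel[of s "inv a" "inv t"] assms by (simp add: inv_mult_group)
  then show ?thesis using assms by (simp add: m_assoc)
qed

text \<open>The values allowed at a new point \<open>x\<close> by the old points \<open>y\<close> form the cosets \<open>C (x \<cdot> y\<^sup>-\<^sup>1) \<cdot> f y\<close>. Those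
  of \<open>y\<close> and \<open>z\<close> meet, because \<open>f y \<cdot> (f z)\<^sup>-\<^sup>1\<close> lies in \<open>C (y \<cdot> z\<^sup>-\<^sup>1) \<subseteq> C (y \<cdot> x\<^sup>-\<^sup>1) \<cdot> C (x \<cdot> z\<^sup>-\<^sup>1)\<close>; by the
  Helly property they all meet.\<close>

lemma difference_map_extends:
  fixes G :: "('a, 'm) monoid_scheme" (structure) and G' :: "('b, 'n) monoid_scheme"
  assumes "group G" "finite (carrier G)" "group G'" "cyclic_group G'"
    and aff: "\<And>z. z \<in> carrier G \<Longrightarrow> affine_subset G' (C z)"
    and C1: "\<one>\<^bsub>G'\<^esub> \<in> C \<one>"
    and Cinv: "\<And>z w. z \<in> carrier G \<Longrightarrow> w \<in> C z \<Longrightarrow> inv\<^bsub>G'\<^esub> w \<in> C (inv z)"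
    and Cmult: "\<And>z w. z \<in> carrier G \<Longrightarrow> w \<in> carrier G \<Longrightarrow> C (z \<otimes> w) \<subseteq> C z <#>\<^bsub>G'\<^esub> C w"
    and T: "T \<subseteq> carrier G" "f0 \<in> T \<rightarrow> carrier G'"
      "\<And>x y. x \<in> T \<Longrightarrow> y \<in> T \<Longrightarrow> f0 x \<otimes>\<^bsub>G'\<^esub> inv\<^bsub>G'\<^esub> f0 y \<in> C (x \<otimes> inv y)"
  obtains f where "f \<in> carrier G \<rightarrow> carrier G'" "\<And>x. x \<in> T \<Longrightarrow> f x = f0 x"
    "\<And>x y. x \<in> carrier G \<Longrightarrow> y \<in> carrier G \<Longrightarrow> f x \<otimes>\<^bsub>G'\<^esub> inv\<^bsub>G'\<^esub> f y \<in> C (x \<otimes> inv y)"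
proof -
  interpret group G by fact
  interpret G': group G' by fact
  have Csub: "w \<in> carrier G'" if "w \<in> C z" "z \<in> carrier G" for w z
    using aff[of z] that by (auto simp: affine_subset_def)
  have "\<exists>f \<in> T \<union> U \<rightarrow> carrier G'. (\<forall>x\<in>T. f x = f0 x) \<and>
      (\<forall>x\<in>T \<union> U. \<forall>y\<in>T \<union> U. f x \<otimes>\<^bsub>G'\<^esub> inv\<^bsub>G'\<^esub> f y \<in> C (x \<otimes> inv y))"
    if "finite U" "U \<subseteq> carrier G - T" for U
    using that
  proof (induction U rule: finite_induct)
    case empty
    show ?case using T by (intro bexI[of _ f0]) auto
  next
    case (insert x U)
    let ?S = "T \<union> U"
    have S: "?S \<subseteq> carrier G" and x: "x \<in> carrier G" "x \<notin> ?S" using insert T by auto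
    have "U \<subseteq> carrier G - T" using insert.prems by blast
    from insert.IH[OF this] obtain f where f: "f \<in> ?S \<rightarrow> carrier G'" "\<forall>x\<in>T. f x = f0 x"
      and fC': "\<forall>x\<in>?S. \<forall>y\<in>?S. f x \<otimes>\<^bsub>G'\<^esub> inv\<^bsub>G'\<^esub> f y \<in> C (x \<otimes> inv y)"
      by (elim bexE conjE)
    note fC = fC'[rule_format]
    have "\<exists>v\<in>carrier G'. \<forall>y\<in>?S. v \<in> {v\<in>carrier G'. v \<otimes>\<^bsub>G'\<^esub> inv\<^bsub>G'\<^esub> f y \<in> C (x \<otimes> inv y)}"
    proof (rule cyclic_affine_Helly[OF assms(3,4)])
      show "finite ?S" using S assms(2) finite_subset by blast
    next
      fix y assume y: "y \<in> ?S"
      then have fy: "f y \<in> carrier G'" and yG: "y \<in> carrier G" using f S by auto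
      show "affine_subset G' {v\<in>carrier G'. v \<otimes>\<^bsub>G'\<^esub> inv\<^bsub>G'\<^esub> f y \<in> C (x \<otimes> inv y)}"
        unfolding affine_subset_def
      proof (intro conjI ballI)
        fix s t u
        assume *: "s \<in> {v\<in>carrier G'. v \<otimes>\<^bsub>G'\<^esub> inv\<^bsub>G'\<^esub> f y \<in> C (x \<otimes> inv y)}"
          "t \<in> {v\<in>carrier G'. v \<otimes>\<^bsub>G'\<^esub> inv\<^bsub>G'\<^esub> f y \<in> C (x \<otimes> inv y)}"
          "u \<in> {v\<in>carrier G'. v \<otimes>\<^bsub>G'\<^esub> inv\<^bsub>G'\<^esub> f y \<in> C (x \<otimes> inv y)}"
        then have "(s \<otimes>\<^bsub>G'\<^esub> inv\<^bsub>G'\<^esub> f y) \<otimes>\<^bsub>G'\<^esub> inv\<^bsub>G'\<^esub> (t \<otimes>\<^bsub>G'\<^esub> inv\<^bsub>G'\<^esub> f y) \<otimes>\<^bsub>G'\<^esub> (u \<otimes>\<^bsub>G'\<^esub> inv\<^bsub>G'\<^esub> f y)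
            \<in> C (x \<otimes> inv y)"
          using aff[of "x \<otimes> inv y"] x yG unfolding affine_subset_def by simp
        also have "(s \<otimes>\<^bsub>G'\<^esub> inv\<^bsub>G'\<^esub> f y) \<otimes>\<^bsub>G'\<^esub> inv\<^bsub>G'\<^esub> (t \<otimes>\<^bsub>G'\<^esub> inv\<^bsub>G'\<^esub> f y) \<otimes>\<^bsub>G'\<^esub> (u \<otimes>\<^bsub>G'\<^esub> inv\<^bsub>G'\<^esub> f y)
            = s \<otimes>\<^bsub>G'\<^esub> inv\<^bsub>G'\<^esub> t \<otimes>\<^bsub>G'\<^esub> u \<otimes>\<^bsub>G'\<^esub> inv\<^bsub>G'\<^esub> f y"
          using * fy by (intro G'.translate_heap) auto
        finally show "s \<otimes>\<^bsub>G'\<^esub> inv\<^bsub>G'\<^esub> t \<otimes>\<^bsub>G'\<^esub> u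
            \<in> {v\<in>carrier G'. v \<otimes>\<^bsub>G'\<^esub> inv\<^bsub>G'\<^esub> f y \<in> C (x \<otimes> inv y)}"
          using * by simp
      qed blast
    next
      fix y z assume y: "y \<in> ?S" and z: "z \<in> ?S"
      then have fy: "f y \<in> carrier G'" "f z \<in> carrier G'" and yG: "y \<in> carrier G" "z \<in> carrier G"
        using f S by auto
      \<comment> \<open>Factoring the difference of \<open>f y\<close> and \<open>f z\<close> through \<open>x\<close> gives the common point
        \<open>t \<cdot> f z = s\<^sup>-\<^sup>1 \<cdot> f y\<close>.\<close>
      have "f y \<otimes>\<^bsub>G'\<^esub> inv\<^bsub>G'\<^esub> f z \<in> C ((y \<otimes> inv x) \<otimes> (x \<otimes> inv z))"
        using fC[OF y z] yG x mult_inv_mult_cancel[of y x "inv z"] by simp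
      then obtain s t where s: "s \<in> C (y \<otimes> inv x)" and t: "t \<in> C (x \<otimes> inv z)"
        and st: "f y \<otimes>\<^bsub>G'\<^esub> inv\<^bsub>G'\<^esub> f z = s \<otimes>\<^bsub>G'\<^esub> t"
        using Cmult[of "y \<otimes> inv x" "x \<otimes> inv z"] yG x unfolding set_mult_def by auto
      have st': "s \<in> carrier G'" "t \<in> carrier G'" using Csub s t yG x by auto
      have "inv\<^bsub>G'\<^esub> s \<in> C (x \<otimes> inv y)"
        using Cinv[OF _ s] yG x by (simp add: inv_mult_group)
      moreover have "t \<otimes>\<^bsub>G'\<^esub> f z = inv\<^bsub>G'\<^esub> s \<otimes>\<^bsub>G'\<^esub> f y"
      proof -
        have "f y = s \<otimes>\<^bsub>G'\<^esub> t \<otimes>\<^bsub>G'\<^esub> f z"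
          using st[symmetric] fy st' by (simp add: G'.m_assoc)
        then have "inv\<^bsub>G'\<^esub> s \<otimes>\<^bsub>G'\<^esub> f y = inv\<^bsub>G'\<^esub> s \<otimes>\<^bsub>G'\<^esub> (s \<otimes>\<^bsub>G'\<^esub> (t \<otimes>\<^bsub>G'\<^esub> f z))"
          using fy st' by (simp only: G'.m_assoc)
        also have "\<dots> = t \<otimes>\<^bsub>G'\<^esub> f z"
          using fy st' by (simp add: G'.m_assoc[symmetric])
        finally show ?thesis by simp
      qed
      moreover have "(inv\<^bsub>G'\<^esub> s \<otimes>\<^bsub>G'\<^esub> f y) \<otimes>\<^bsub>G'\<^esub> inv\<^bsub>G'\<^esub> f y = inv\<^bsub>G'\<^esub> s"
        "(t \<otimes>\<^bsub>G'\<^esub> f z) \<otimes>\<^bsub>G'\<^esub> inv\<^bsub>G'\<^esub> f z = t"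
        using fy st' by (simp_all add: G'.m_assoc)
      ultimately have "t \<otimes>\<^bsub>G'\<^esub> f z \<in> {v\<in>carrier G'. v \<otimes>\<^bsub>G'\<^esub> inv\<^bsub>G'\<^esub> f y \<in> C (x \<otimes> inv y)} \<inter>
          {v\<in>carrier G'. v \<otimes>\<^bsub>G'\<^esub> inv\<^bsub>G'\<^esub> f z \<in> C (x \<otimes> inv z)}"
        using t fy st' by auto
      then show "{v\<in>carrier G'. v \<otimes>\<^bsub>G'\<^esub> inv\<^bsub>G'\<^esub> f y \<in> C (x \<otimes> inv y)} \<inter>
          {v\<in>carrier G'. v \<otimes>\<^bsub>G'\<^esub> inv\<^bsub>G'\<^esub> f z \<in> C (x \<otimes> inv z)} \<noteq> {}" by blast
    qed
    then obtain v where v: "v \<in> carrier G'"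
      "\<And>y. y \<in> ?S \<Longrightarrow> v \<otimes>\<^bsub>G'\<^esub> inv\<^bsub>G'\<^esub> f y \<in> C (x \<otimes> inv y)" by (elim bexE) simp
    have v': "f y \<otimes>\<^bsub>G'\<^esub> inv\<^bsub>G'\<^esub> v \<in> C (y \<otimes> inv x)" if "y \<in> ?S" for y
    proof -
      have "f y \<in> carrier G'" "y \<in> carrier G" using that f S by auto
      then show ?thesis
        using Cinv[OF _ v(2)[OF that]] v(1) x by (simp add: G'.inv_mult_group inv_mult_group)
    qed
    have vv: "v \<otimes>\<^bsub>G'\<^esub> inv\<^bsub>G'\<^esub> v \<in> C (x \<otimes> inv x)" using v(1) x(1) C1 by simp
    show ?case
    proof (intro bexI conjI ballI)
      show "f(x := v) \<in> T \<union> insert x U \<rightarrow> carrier G'" using v(1) f(1) by auto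
      show "(f(x := v)) y = f0 y" if "y \<in> T" for y using that x(2) f(2) by auto
      show "(f(x := v)) y \<otimes>\<^bsub>G'\<^esub> inv\<^bsub>G'\<^esub> (f(x := v)) z \<in> C (y \<otimes> inv z)"
        if "y \<in> T \<union> insert x U" "z \<in> T \<union> insert x U" for y z
        using that vv v(2) v' fC by (cases "y = x"; cases "z = x") simp_all
    qed
  qed
  from this[of "carrier G - T"] obtain f where "f \<in> carrier G \<rightarrow> carrier G'" "\<forall>x\<in>T. f x = f0 x"
    "\<forall>x\<in>carrier G. \<forall>y\<in>carrier G. f x \<otimes>\<^bsub>G'\<^esub> inv\<^bsub>G'\<^esub> f y \<in> C (x \<otimes> inv y)"
    using T(1) assms(2) by (auto simp: Un_absorb1)
  then show ?thesis using that by simp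
qed

section \<open>Basic sets and supports of products\<close>

lemma S_ring_span_mem:
  assumes "S_ring G A"
  shows "(\<lambda>x. \<Sum>X\<in>basic_sets G A. c X * set_elem X x) \<in> A"
  using basic_partition_basic_sets[OF assms] unfolding basic_partition_def by blast

lemma S_ring_spanE:
  assumes "S_ring G A" "a \<in> A"
  obtains c where "a = (\<lambda>x. \<Sum>X\<in>basic_sets G A. c X * set_elem X x)"
  using basic_partition_basic_sets[OF assms(1)] assms(2) unfolding basic_partition_def by blast

lemma finite_basic_sets: "S_ring G A \<Longrightarrow> finite (basic_sets G A)"
  using basic_partition_basic_sets[of G A]
  by (auto simp: basic_partition_def S_ring_def intro: finite_elements)

lemma basic_sets_cover:
  assumes "S_ring G A" "x \<in> carrier G"
  obtains X where "X \<in> basic_sets G A" "x \<in> X"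
  using basic_partition_basic_sets[OF assms(1)] assms(2) partition_onD1[of "carrier G"]
  unfolding basic_partition_def by blast

lemma basic_sets_subset: "S_ring G A \<Longrightarrow> X \<in> basic_sets G A \<Longrightarrow> X \<subseteq> carrier G"
  using basic_partition_basic_sets[of G A] by (auto simp: basic_partition_def partition_on_def)

lemma basic_sets_nonempty: "S_ring G A \<Longrightarrow> X \<in> basic_sets G A \<Longrightarrow> X \<noteq> {}"
  using basic_partition_basic_sets[of G A] by (auto simp: basic_partition_def partition_on_def)

lemma basic_sets_eq:
  "S_ring G A \<Longrightarrow> X \<in> basic_sets G A \<Longrightarrow> Y \<in> basic_sets G A \<Longrightarrow> x \<in> X \<Longrightarrow> x \<in> Y \<Longrightarrow> X = Y"
  using basic_partition_basic_sets[of G A]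
  by (auto simp: basic_partition_def partition_on_def disjoint_def)

lemma basic_sets_one: "S_ring G A \<Longrightarrow> {\<one>\<^bsub>G\<^esub>} \<in> basic_sets G A"
  using basic_partition_basic_sets[of G A] by (auto simp: basic_partition_def)

lemma basic_sets_inv: "S_ring G A \<Longrightarrow> X \<in> basic_sets G A \<Longrightarrow> set_inv\<^bsub>G\<^esub> X \<in> basic_sets G A"
  using basic_partition_basic_sets[of G A] by (auto simp: basic_partition_def)

lemma S_ring_diff:
  assumes "S_ring G A" "a \<in> A" "b \<in> A"
  shows "(\<lambda>x. a x - b x) \<in> A"
proof -
  obtain c where c: "a = (\<lambda>x. \<Sum>X\<in>basic_sets G A. c X * set_elem X x)"
    by (rule S_ring_spanE[OF assms(1,2)])
  obtain d where d: "b = (\<lambda>x. \<Sum>X\<in>basic_sets G A. d X * set_elem X x)"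
    by (rule S_ring_spanE[OF assms(1,3)])
  show ?thesis
    unfolding c d
    using S_ring_span_mem[OF assms(1), of "\<lambda>X. c X - d X"]
    by (simp add: left_diff_distrib sum_subtractf)
qed

lemma set_elem_mem:
  assumes "S_ring G A" "X \<in> basic_sets G A"
  shows "set_elem X \<in> A"
proof -
  have "(\<Sum>Y\<in>basic_sets G A. of_bool (Y = X) * set_elem Y x)
      = (\<Sum>Y\<in>basic_sets G A. if Y = X then set_elem Y x else 0)" for x
    by (intro sum.cong) auto
  then show ?thesis
    using S_ring_span_mem[OF assms(1), of "\<lambda>Y. of_bool (Y = X)"]
      finite_basic_sets[OF assms(1)] assms(2)
    by simp
qed

text \<open>An S-ring is generated by the elements of its basic sets under subtraction alone: sums and integer
  multiples are iterated differences.\<close>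

lemma S_ring_induct [consumes 2, case_names set_elem diff]:
  assumes S_ring: "S_ring G A" and "a \<in> A"
    and elem: "\<And>X. X \<in> basic_sets G A \<Longrightarrow> P (set_elem X)"
    and diff: "\<And>a b. a \<in> A \<Longrightarrow> b \<in> A \<Longrightarrow> P a \<Longrightarrow> P b \<Longrightarrow> P (\<lambda>x. a x - b x)"
  shows "P a"
proof -
  define Q where "Q a \<longleftrightarrow> a \<in> A \<and> P a" for a
  have elem: "Q (set_elem X)" if "X \<in> basic_sets G A" for X
    using that elem set_elem_mem[OF S_ring] by (simp add: Q_def)
  have diff: "Q (\<lambda>x. a x - b x)" if "Q a" "Q b" for a b
    using that diff S_ring_diff[OF S_ring] by (simp add: Q_def)
  have zero: "Q (\<lambda>_. 0)" using diff[OF elem elem, OF basic_sets_one basic_sets_one] S_ring by simp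
  have add: "Q (\<lambda>x. a x + b x)" if "Q a" "Q b" for a b
    using diff[OF that(1) diff[OF zero that(2)]] by simp
  have scale: "Q (\<lambda>x. c * set_elem X x)" if X: "X \<in> basic_sets G A" for X and c :: int
  proof (induction c rule: int_induct[where k = 0])
    case base
    show ?case using zero by simp
  next
    case (step1 i)
    show ?case using add[OF step1(2) elem[OF X]] by (simp add: algebra_simps)
  next
    case (step2 i)
    show ?case using diff[OF step2(2) elem[OF X]] by (simp add: algebra_simps)
  qed
  obtain c where c: "a = (\<lambda>x. \<Sum>X\<in>basic_sets G A. c X * set_elem X x)"
    by (rule S_ring_spanE[OF S_ring \<open>a \<in> A\<close>])
  have "Q (\<lambda>x. \<Sum>X\<in>T. c X * set_elem X x)" if "finite T" "T \<subseteq> basic_sets G A" for T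
    using that by (induction T rule: finite_induct) (auto intro: zero add scale)
  from this[OF finite_basic_sets[OF S_ring]] have "Q a" by (simp add: c)
  then show ?thesis by (simp add: Q_def)
qed

lemma set_elem_inj: "set_elem X = set_elem Y \<longleftrightarrow> X = Y"
  by (auto simp: set_elem_def fun_eq_iff)

lemma group_ring_mult_nonneg:
  assumes "\<And>x. 0 \<le> a x" "\<And>x. 0 \<le> b x"
  shows "0 \<le> (a \<otimes>\<^bsub>group_ring G\<^esub> b) x"
  unfolding group_ring_def by (auto intro!: sum_nonneg simp: assms)

text \<open>Nonnegative coefficients cannot cancel, so the support of the product is the product of the supports.\<close>

lemma group_ring_mult_nonzero_iff:
  assumes "group G" "finite (carrier G)" "x \<in> carrier G" "\<And>x. 0 \<le> a x" "\<And>x. 0 \<le> b x"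
  shows "(a \<otimes>\<^bsub>group_ring G\<^esub> b) x \<noteq> 0 \<longleftrightarrow>
    (\<exists>y\<in>carrier G. \<exists>z\<in>carrier G. a y \<noteq> 0 \<and> b z \<noteq> 0 \<and> x = y \<otimes>\<^bsub>G\<^esub> z)"
proof -
  interpret group G by fact
  have "(a \<otimes>\<^bsub>group_ring G\<^esub> b) x \<noteq> 0
      \<longleftrightarrow> (\<exists>y\<in>carrier G. a y * b (inv\<^bsub>G\<^esub> y \<otimes>\<^bsub>G\<^esub> x) \<noteq> 0)"
    using assms by (subst group_ring_mult) (auto simp: sum_nonneg_eq_0_iff)
  also have "\<dots> \<longleftrightarrow> (\<exists>y\<in>carrier G. \<exists>z\<in>carrier G. a y \<noteq> 0 \<and> b z \<noteq> 0 \<and> x = y \<otimes>\<^bsub>G\<^esub> z)"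
  proof (rule bex_cong[OF refl])
    fix y assume "y \<in> carrier G"
    then have "x = y \<otimes>\<^bsub>G\<^esub> z \<longleftrightarrow> z = inv\<^bsub>G\<^esub> y \<otimes>\<^bsub>G\<^esub> x" if "z \<in> carrier G" for z
      using that assms(3) by (simp add: inv_solve_left)
    moreover have "inv\<^bsub>G\<^esub> y \<otimes>\<^bsub>G\<^esub> x \<in> carrier G" using \<open>y \<in> carrier G\<close> assms(3) by simp
    ultimately show "a y * b (inv\<^bsub>G\<^esub> y \<otimes>\<^bsub>G\<^esub> x) \<noteq> 0
        \<longleftrightarrow> (\<exists>z\<in>carrier G. a y \<noteq> 0 \<and> b z \<noteq> 0 \<and> x = y \<otimes>\<^bsub>G\<^esub> z)"
      by auto
  qed
  finally show ?thesis .
qed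

lemma set_elem_mult_nonzero_iff:
  assumes "group G" "finite (carrier G)" "x \<in> carrier G" "X \<subseteq> carrier G" "Y \<subseteq> carrier G"
  shows "(set_elem X \<otimes>\<^bsub>group_ring G\<^esub> set_elem Y) x \<noteq> 0 \<longleftrightarrow> x \<in> X <#>\<^bsub>G\<^esub> Y"
  using assms by (subst group_ring_mult_nonzero_iff) (auto simp: set_elem_def set_mult_def)

text \<open>The size of a basic set is a structure constant of the S-ring, hence invariant under similarities.\<close>

lemma set_elem_mult_inv_at_one:
  assumes "group G" "finite (carrier G)" "X \<subseteq> carrier G"
  shows "(set_elem X \<otimes>\<^bsub>group_ring G\<^esub> set_elem (set_inv\<^bsub>G\<^esub> X)) \<one>\<^bsub>G\<^esub> = int (card X)"
proof -
  interpret group G by fact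
  have "(set_elem X \<otimes>\<^bsub>group_ring G\<^esub> set_elem (set_inv\<^bsub>G\<^esub> X)) \<one>\<^bsub>G\<^esub>
      = (\<Sum>y\<in>carrier G. of_bool (y \<in> X))"
    using assms(3) by (subst group_ring_mult) (auto simp: set_elem_def SET_INV_def intro!: sum.cong)
  also have "\<dots> = int (card X)"
    using assms by (simp add: Int_absorb1 flip: sum.inter_filter)
  finally show ?thesis .
qed

section \<open>Images of basic sets under a similarity\<close>

locale coset_similarity =
  fixes G :: "('a, 'm) monoid_scheme" (structure) and A
    and G' :: "('b, 'n) monoid_scheme" and A' \<phi>
  assumes S_ring: "S_ring G A" and S_ring': "S_ring G' A'"
    and coset: "\<And>X. X \<in> basic_sets G A \<Longrightarrow> \<exists>H. subgroup H G \<and> X \<in> rcosets H"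
    and sim: "similarity G A G' A' \<phi>"
begin

lemma is_group: "group G" "group G'" "finite (carrier G)" "finite (carrier G')"
  using S_ring S_ring' by (auto simp: S_ring_def)

sublocale G: group G by (rule is_group)
sublocale G': group G' by (rule is_group)

lemma sim_add: "a \<in> A \<Longrightarrow> b \<in> A \<Longrightarrow> \<phi> (\<lambda>x. a x + b x) = (\<lambda>y. \<phi> a y + \<phi> b y)"
  using sim unfolding similarity_def ring_iso_def ring_hom_def by (simp add: group_ring_def)

lemma sim_mult: "a \<in> A \<Longrightarrow> b \<in> A \<Longrightarrow> \<phi> (a \<otimes>\<^bsub>group_ring G\<^esub> b) = \<phi> a \<otimes>\<^bsub>group_ring G'\<^esub> \<phi> b"
  using sim unfolding similarity_def ring_iso_def ring_hom_def by simp

lemma sim_inj: "inj_on \<phi> A"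
  using sim unfolding similarity_def ring_iso_def bij_betw_def by simp

lemma sim_one: "\<phi> (set_elem {\<one>}) = set_elem {\<one>\<^bsub>G'\<^esub>}"
  using sim unfolding similarity_def ring_iso_def ring_hom_def
  by (simp add: group_ring_def set_elem_def)

lemma mult_mem: "a \<in> A \<Longrightarrow> b \<in> A \<Longrightarrow> a \<otimes>\<^bsub>group_ring G\<^esub> b \<in> A"
  using S_ring by (auto simp: S_ring_def dest: subringE(6))

lemma sim_diff:
  assumes "a \<in> A" "b \<in> A"
  shows "\<phi> (\<lambda>x. a x - b x) = (\<lambda>y. \<phi> a y - \<phi> b y)"
  using sim_add[OF S_ring_diff[OF S_ring assms] assms(2)] by (simp add: fun_eq_iff)

text \<open>A similarity transports coefficients: it moves basic sets bijectively and keeps the coefficient at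
  each. Everything known about coefficients of products in \<open>A\<close> passes to \<open>A'\<close> through this lemma.\<close>

lemma sim_value:
  assumes "a \<in> A" "X \<in> basic_sets G A" "X' \<in> basic_sets G' A'" "\<phi> (set_elem X) = set_elem X'"
    "x \<in> X" "y \<in> X'"
  shows "\<phi> a y = a x"
  using S_ring \<open>a \<in> A\<close>
proof (induction a rule: S_ring_induct)
  case (set_elem Z)
  obtain Z' where Z': "Z' \<in> basic_sets G' A'" "\<phi> (set_elem Z) = set_elem Z'"
    using sim set_elem unfolding similarity_def by blast
  have "y \<in> Z' \<longleftrightarrow> X' = Z'" using basic_sets_eq[OF S_ring' assms(3) Z'(1) assms(6)] assms(6) by blast
  also have "\<dots> \<longleftrightarrow> X = Z"
  proof
    assume "X' = Z'"
    then have "\<phi> (set_elem X) = \<phi> (set_elem Z)" using assms(4) Z'(2) by simp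
    then have "set_elem X = set_elem Z"
      using inj_onD[OF sim_inj] set_elem_mem[OF S_ring] assms(2) set_elem by blast
    then show "X = Z" by (simp add: set_elem_inj)
  next
    assume "X = Z"
    then have "set_elem X' = set_elem Z'" using assms(4) Z'(2) by simp
    then show "X' = Z'" by (simp add: set_elem_inj)
  qed
  also have "\<dots> \<longleftrightarrow> x \<in> Z" using basic_sets_eq[OF S_ring assms(2) set_elem assms(5)] assms(5) by blast
  finally show ?case using Z'(2) by (simp add: set_elem_def)
qed (simp add: sim_diff)

text \<open>The set \<open>X\<^sup>\<phi>\<close> for the basic set \<open>X\<close> containing \<open>z\<close> (see \<open>image_class_eq\<close>), in a form that does not need
  to choose \<open>X\<close>.\<close>

definition image_class :: "'a \<Rightarrow> 'b set" where
  "image_class z = {y \<in> carrier G'. \<forall>a\<in>A. \<phi> a y = a z}"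

lemma image_class_eq:
  assumes "X \<in> basic_sets G A" "X' \<in> basic_sets G' A'" "\<phi> (set_elem X) = set_elem X'" "z \<in> X"
  shows "image_class z = X'"
proof
  show "X' \<subseteq> image_class z"
    using sim_value[OF _ assms] basic_sets_subset[OF S_ring' assms(2)] by (auto simp: image_class_def)
  show "image_class z \<subseteq> X'"
  proof
    fix y assume "y \<in> image_class z"
    then have "set_elem X' y = set_elem X z"
      using set_elem_mem[OF S_ring assms(1)] assms(3) by (auto simp: image_class_def)
    then show "y \<in> X'" using assms(4) by (simp add: set_elem_def split: if_splits)
  qed
qed

lemma image_class_basic:
  assumes "z \<in> carrier G"
  obtains X where "X \<in> basic_sets G A" "z \<in> X" "image_class z \<in> basic_sets G' A'"
    "\<phi> (set_elem X) = set_elem (image_class z)"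
proof -
  obtain X where X: "X \<in> basic_sets G A" "z \<in> X" using basic_sets_cover[OF S_ring assms] .
  obtain X' where X': "X' \<in> basic_sets G' A'" "\<phi> (set_elem X) = set_elem X'"
    using sim X(1) unfolding similarity_def by blast
  show ?thesis using that[OF X] X' image_class_eq[OF X(1) X' X(2)] by simp
qed

text \<open>At a point outside all images the elements of \<open>\<phi> ` A = A'\<close> would all vanish, but \<open>A'\<close> contains the
  basic set of that point.\<close>

lemma image_class_cover:
  assumes "y \<in> carrier G'"
  shows "\<exists>z\<in>carrier G. y \<in> image_class z"
proof (rule ccontr)
  assume "\<not> ?thesis"
  then have none: "y \<notin> image_class z" if "z \<in> carrier G" for z using that by simp
  have vanish: "\<phi> a y = 0" if "a \<in> A" for a
    using S_ring that
  proof (induction a rule: S_ring_induct)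
    case (set_elem X)
    then obtain z where z: "z \<in> X" using basic_sets_nonempty[OF S_ring] by blast
    then have zG: "z \<in> carrier G" using basic_sets_subset[OF S_ring set_elem] by blast
    obtain Y where Y: "Y \<in> basic_sets G A" "z \<in> Y" "\<phi> (set_elem Y) = set_elem (image_class z)"
      by (rule image_class_basic[OF zG])
    have "X = Y" using basic_sets_eq[OF S_ring set_elem Y(1) z Y(2)] .
    then show ?case using Y(3) none[OF zG] by (simp add: set_elem_def)
  qed (simp add: sim_diff)
  obtain Z where Z: "Z \<in> basic_sets G' A'" "y \<in> Z" using basic_sets_cover[OF S_ring' assms] .
  have "set_elem Z \<in> \<phi> ` A"
    using set_elem_mem[OF S_ring' Z(1)] sim
    unfolding similarity_def ring_iso_def bij_betw_def by simp
  then have "set_elem Z y = 0" using vanish by auto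
  then show False using Z(2) by (simp add: set_elem_def)
qed

lemma image_class_value: "y \<in> image_class z \<Longrightarrow> a \<in> A \<Longrightarrow> \<phi> a y = a z"
  by (simp add: image_class_def)

lemma image_class_subset: "image_class z \<subseteq> carrier G'"
  by (auto simp: image_class_def)

lemma image_class_one: "image_class \<one> = {\<one>\<^bsub>G'\<^esub>}"
  using image_class_eq[OF basic_sets_one[OF S_ring] basic_sets_one[OF S_ring'] sim_one] by simp

lemma image_class_eq_one:
  assumes "z \<in> carrier G" "\<one>\<^bsub>G'\<^esub> \<in> image_class z"
  shows "z = \<one>"
proof -
  have "set_elem {\<one>} z = \<phi> (set_elem {\<one>}) \<one>\<^bsub>G'\<^esub>"
    using assms(2) set_elem_mem[OF S_ring basic_sets_one[OF S_ring]] by (simp add: image_class_def)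
  then show ?thesis unfolding sim_one by (simp add: set_elem_def split: if_splits)
qed

text \<open>The coefficient of \<open>X \<cdot> Y\<close> at \<open>z \<cdot> w\<close>, where \<open>z \<in> X\<close> and \<open>w \<in> Y\<close>, is nonzero, and \<open>\<phi>\<close> transports it to the
  coefficient of \<open>X\<^sup>\<phi> \<cdot> Y\<^sup>\<phi>\<close> at each point of the image of the class of \<open>z \<cdot> w\<close>.\<close>

lemma image_class_mult:
  assumes "z \<in> carrier G" "w \<in> carrier G"
  shows "image_class (z \<otimes> w) \<subseteq> image_class z <#>\<^bsub>G'\<^esub> image_class w"
proof
  fix y assume y: "y \<in> image_class (z \<otimes> w)"
  obtain X where X: "X \<in> basic_sets G A" "z \<in> X" "\<phi> (set_elem X) = set_elem (image_class z)"
    by (rule image_class_basic[OF assms(1)])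
  obtain Y where Y: "Y \<in> basic_sets G A" "w \<in> Y" "\<phi> (set_elem Y) = set_elem (image_class w)"
    by (rule image_class_basic[OF assms(2)])
  note mem = set_elem_mem[OF S_ring X(1)] set_elem_mem[OF S_ring Y(1)]
  have "(set_elem (image_class z) \<otimes>\<^bsub>group_ring G'\<^esub> set_elem (image_class w)) y
      = (set_elem X \<otimes>\<^bsub>group_ring G\<^esub> set_elem Y) (z \<otimes> w)"
    using image_class_value[OF y mult_mem[OF mem]] sim_mult[OF mem] X(3) Y(3) by simp
  also have "\<dots> \<noteq> 0"
    using set_elem_mult_nonzero_iff[OF is_group(1,3), of "z \<otimes> w" X Y] assms X Y
      basic_sets_subset[OF S_ring] by (auto simp: set_mult_def)
  finally show "y \<in> image_class z <#>\<^bsub>G'\<^esub> image_class w"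
    using set_elem_mult_nonzero_iff[OF is_group(2,4), of y] y image_class_subset by blast
qed

text \<open>Since \<open>1 = z \<cdot> z\<^sup>-\<^sup>1\<close>, \<open>image_class_mult\<close> gives a point of the image of \<open>z\<^sup>-\<^sup>1\<close> that is inverse to a point of the
  image of \<open>z\<close>; two basic sets that share a point coincide.\<close>

lemma image_class_set_inv:
  assumes "z \<in> carrier G"
  shows "image_class (inv z) = set_inv\<^bsub>G'\<^esub> (image_class z)"
proof -
  have "\<one>\<^bsub>G'\<^esub> \<in> image_class (z \<otimes> inv z)" using assms image_class_one by simp
  then obtain s t where s: "s \<in> image_class z" and t: "t \<in> image_class (inv z)" and "\<one>\<^bsub>G'\<^esub> = s \<otimes>\<^bsub>G'\<^esub> t"
    using image_class_mult[of z "inv z"] assms by (auto simp: set_mult_def)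
  moreover have "s \<in> carrier G'" "t \<in> carrier G'" using s t image_class_subset by auto
  ultimately have "t = inv\<^bsub>G'\<^esub> s" by (metis G'.inv_equality G'.inv_inv G'.inv_closed)
  then have "t \<in> set_inv\<^bsub>G'\<^esub> (image_class z)" using s by (auto simp: SET_INV_def)
  moreover have "image_class (inv z) \<in> basic_sets G' A'"
    by (rule image_class_basic[OF G.inv_closed[OF assms]])
  moreover have "set_inv\<^bsub>G'\<^esub> (image_class z) \<in> basic_sets G' A'"
    by (rule image_class_basic[OF assms]) (rule basic_sets_inv[OF S_ring'])
  ultimately show ?thesis using basic_sets_eq[OF S_ring'] t by blast
qed

lemma card_image_class:
  assumes "X \<in> basic_sets G A" "z \<in> X"
  shows "card (image_class z) = card X"
proof -
  have z: "z \<in> carrier G" using assms basic_sets_subset[OF S_ring] by auto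
  obtain X' where X': "X' \<in> basic_sets G' A'" "\<phi> (set_elem X) = set_elem X'"
    using sim assms(1) unfolding similarity_def by blast
  note img = image_class_eq[OF assms(1) X' assms(2)]
  have inv: "set_inv X \<in> basic_sets G A" "inv z \<in> set_inv X"
    using basic_sets_inv[OF S_ring assms(1)] assms(2) by (auto simp: SET_INV_def)
  have inv': "\<phi> (set_elem (set_inv X)) = set_elem (set_inv\<^bsub>G'\<^esub> X')"
  proof -
    obtain Y where "Y \<in> basic_sets G A" "inv z \<in> Y" "\<phi> (set_elem Y) = set_elem (image_class (inv z))"
      by (rule image_class_basic[OF G.inv_closed[OF z]])
    moreover have "Y = set_inv X" using basic_sets_eq[OF S_ring] calculation inv by blast
    ultimately show ?thesis using image_class_set_inv[OF z] img by simp
  qed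
  note mem = set_elem_mem[OF S_ring assms(1)] set_elem_mem[OF S_ring inv(1)]
  have "int (card X') = (set_elem X' \<otimes>\<^bsub>group_ring G'\<^esub> set_elem (set_inv\<^bsub>G'\<^esub> X')) \<one>\<^bsub>G'\<^esub>"
    using set_elem_mult_inv_at_one[OF is_group(2,4)] basic_sets_subset[OF S_ring' X'(1)] by simp
  also have "\<dots> = \<phi> (set_elem X \<otimes>\<^bsub>group_ring G\<^esub> set_elem (set_inv X)) \<one>\<^bsub>G'\<^esub>"
    using sim_mult[OF mem] X' inv' by simp
  also have "\<dots> = (set_elem X \<otimes>\<^bsub>group_ring G\<^esub> set_elem (set_inv X)) \<one>"
    using sim_value[OF mult_mem[OF mem] basic_sets_one[OF S_ring] basic_sets_one[OF S_ring'] sim_one] by simp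
  also have "\<dots> = int (card X)"
    using set_elem_mult_inv_at_one[OF is_group(1,3)] basic_sets_subset[OF S_ring assms(1)] by simp
  finally show ?thesis using img by simp
qed

text \<open>As \<open>X\<close> is a coset, the support of \<open>X \<cdot> X\<^sup>-\<^sup>1 \<cdot> X\<close> lies in \<open>X\<close>. The similarity carries this product to
  \<open>X\<^sup>\<phi> \<cdot> (X\<^sup>\<phi>)\<^sup>-\<^sup>1 \<cdot> X\<^sup>\<phi>\<close>, whose support therefore lies in \<open>X\<^sup>\<phi>\<close>; that is affinity of \<open>X\<^sup>\<phi>\<close>.\<close>

lemma image_class_affine:
  assumes z: "z \<in> carrier G"
  shows "affine_subset G' (image_class z)"
proof -
  obtain X where X: "X \<in> basic_sets G A" "z \<in> X" "image_class z \<in> basic_sets G' A'"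
    "\<phi> (set_elem X) = set_elem (image_class z)"
    by (rule image_class_basic[OF z])
  obtain X1 where X1: "X1 \<in> basic_sets G A" "inv z \<in> X1"
    "\<phi> (set_elem X1) = set_elem (image_class (inv z))"
    by (rule image_class_basic[OF G.inv_closed[OF z]])
  have X1_inv: "X1 = set_inv X"
    using basic_sets_eq[OF S_ring X1(1) basic_sets_inv[OF S_ring X(1)] X1(2)] X(2)
    by (auto simp: SET_INV_def)
  have XG: "X \<subseteq> carrier G" "X1 \<subseteq> carrier G" using basic_sets_subset[OF S_ring] X X1 by auto
  note mem = set_elem_mem[OF S_ring X(1)] set_elem_mem[OF S_ring X1(1)]
  let ?b = "set_elem X \<otimes>\<^bsub>group_ring G\<^esub> set_elem X1"
  let ?b' = "set_elem (image_class z) \<otimes>\<^bsub>group_ring G'\<^esub> set_elem (image_class (inv z))"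
  have nn: "0 \<le> ?b x" "0 \<le> ?b' y" for x y
    by (auto intro!: group_ring_mult_nonneg simp: set_elem_def)
  have closed: "s \<otimes> inv t \<otimes> u \<in> X" if "s \<in> X" "t \<in> X" "u \<in> X" for s t u
  proof -
    obtain H a where H: "subgroup H G" and a: "a \<in> carrier G" and Xa: "X = H #> a"
      using coset[OF X(1)] by (auto simp: RCOSETS_def)
    interpret H: subgroup H G by fact
    have in_X: "\<exists>h\<in>H. v = h \<otimes> a" if "v \<in> X" for v
      using that unfolding Xa r_coset_def by blast
    obtain h where h: "h \<in> H" "s = h \<otimes> a" using in_X[OF \<open>s \<in> X\<close>] ..
    obtain k where k: "k \<in> H" "t = k \<otimes> a" using in_X[OF \<open>t \<in> X\<close>] ..
    obtain l where l: "l \<in> H" "u = l \<otimes> a" using in_X[OF \<open>u \<in> X\<close>] ..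
    have "s \<otimes> inv t \<otimes> u = (h \<otimes> inv k \<otimes> l) \<otimes> a"
      using G.translate_heap[of h k l a] a h k l H.mem_carrier by simp
    moreover have "h \<otimes> inv k \<otimes> l \<in> H" using h k l by simp
    ultimately show ?thesis unfolding Xa r_coset_def by blast
  qed
  have "s \<otimes>\<^bsub>G'\<^esub> inv\<^bsub>G'\<^esub> t \<otimes>\<^bsub>G'\<^esub> u \<in> image_class z"
    if stu: "s \<in> image_class z" "t \<in> image_class z" "u \<in> image_class z" for s t u
  proof -
    let ?y = "s \<otimes>\<^bsub>G'\<^esub> inv\<^bsub>G'\<^esub> t \<otimes>\<^bsub>G'\<^esub> u"
    have stuG: "s \<in> carrier G'" "t \<in> carrier G'" "u \<in> carrier G'" using stu image_class_subset by auto
    have "inv\<^bsub>G'\<^esub> t \<in> image_class (inv z)"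
      using stu image_class_set_inv[OF z] by (auto simp: SET_INV_def)
    then have "s \<otimes>\<^bsub>G'\<^esub> inv\<^bsub>G'\<^esub> t \<in> image_class z <#>\<^bsub>G'\<^esub> image_class (inv z)"
      using stu(1) unfolding set_mult_def by blast
    then have b': "?b' (s \<otimes>\<^bsub>G'\<^esub> inv\<^bsub>G'\<^esub> t) \<noteq> 0"
      using set_elem_mult_nonzero_iff[OF is_group(2,4) _ image_class_subset image_class_subset] stuG
      by simp
    have "(?b' \<otimes>\<^bsub>group_ring G'\<^esub> set_elem (image_class z)) ?y \<noteq> 0"
    proof (subst group_ring_mult_nonzero_iff[OF is_group(2,4)])
      show "\<exists>v\<in>carrier G'. \<exists>w\<in>carrier G'. ?b' v \<noteq> 0 \<and> set_elem (image_class z) w \<noteq> 0 \<and> ?y = v \<otimes>\<^bsub>G'\<^esub> w"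
        using b' stuG stu(3)
        by (intro bexI[of _ "s \<otimes>\<^bsub>G'\<^esub> inv\<^bsub>G'\<^esub> t"] bexI[of _ u]) (simp_all add: set_elem_def)
    qed (use stuG nn in \<open>simp_all add: set_elem_def\<close>)
    then have ne: "\<phi> (?b \<otimes>\<^bsub>group_ring G\<^esub> set_elem X) ?y \<noteq> 0"
      using sim_mult[OF mult_mem[OF mem] mem(1)] sim_mult[OF mem] X(4) X1(3) by simp
    have "?y \<in> carrier G'" using stuG by simp
    from image_class_cover[OF this] obtain x where x: "x \<in> carrier G" "?y \<in> image_class x" ..
    have "(?b \<otimes>\<^bsub>group_ring G\<^esub> set_elem X) x \<noteq> 0"
      using ne image_class_value[OF x(2) mult_mem[OF mult_mem[OF mem] mem(1)]] by simp
    then obtain v u where v: "?b v \<noteq> 0" "v \<in> carrier G" and u: "u \<in> X" "x = v \<otimes> u"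
      using group_ring_mult_nonzero_iff[OF is_group(1,3) x(1), of ?b "set_elem X"] nn(1)
      by (auto simp: set_elem_def split: if_splits)
    have "v \<in> X <#> X1" using v set_elem_mult_nonzero_iff[OF is_group(1,3) v(2) XG] by simp
    then obtain s t where "s \<in> X" "t \<in> X" "v = s \<otimes> inv t"
      unfolding X1_inv set_mult_def SET_INV_def by blast
    then have "x \<in> X" using closed[of s t u] u by simp
    then have "image_class x = image_class z" using image_class_eq[OF X(1) X(3) X(4)] by simp
    then show ?thesis using x(2) by simp
  qed
  then show ?thesis using image_class_subset by (auto simp: affine_subset_def)
qed

section \<open>Isomorphisms that induce a similarity\<close>

text \<open>The prescribed value at \<open>x0\<close> is what schurity needs: it moves \<open>x0\<close> to any point of its image class.\<close>

lemma induced_map_extends: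
  assumes "cyclic_group G'" "x0 \<in> carrier G" "y0 \<in> image_class x0"
  obtains f where "f \<in> carrier G \<rightarrow> carrier G'" "f \<one> = \<one>\<^bsub>G'\<^esub>" "f x0 = y0"
    "\<And>x y. x \<in> carrier G \<Longrightarrow> y \<in> carrier G \<Longrightarrow> f x \<otimes>\<^bsub>G'\<^esub> inv\<^bsub>G'\<^esub> f y \<in> image_class (x \<otimes> inv y)"
proof -
  define f0 where "f0 = (\<lambda>x. if x = \<one> then \<one>\<^bsub>G'\<^esub> else y0)"
  have y0: "y0 \<in> carrier G'" using assms(3) image_class_subset by blast
  have f0x0: "f0 x0 = y0" using assms(3) image_class_one by (auto simp: f0_def)
  have inv_mem: "inv\<^bsub>G'\<^esub> w \<in> image_class (inv z)" if "z \<in> carrier G" "w \<in> image_class z" for z w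
    using that image_class_set_inv by (auto simp: SET_INV_def)
  have diff: "f0 x \<otimes>\<^bsub>G'\<^esub> inv\<^bsub>G'\<^esub> f0 y \<in> image_class (x \<otimes> inv y)"
    if "x \<in> {\<one>, x0}" "y \<in> {\<one>, x0}" for x y
  proof (cases "x = y")
    case True
    then show ?thesis using that assms(2) y0 by (auto simp: f0_def image_class_one)
  next
    case False
    then show ?thesis using that assms(2,3) y0 inv_mem by (auto simp: f0_def)
  qed
  show ?thesis
  proof (rule difference_map_extends[OF is_group(1,3,2) assms(1), where C = image_class and T = "{\<one>, x0}" and ?f0.0 = f0])
    show "\<And>z. z \<in> carrier G \<Longrightarrow> affine_subset G' (image_class z)" by (rule image_class_affine)
    show "\<one>\<^bsub>G'\<^esub> \<in> image_class \<one>" by (simp add: image_class_one)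
    show "\<And>z w. z \<in> carrier G \<Longrightarrow> w \<in> image_class z \<Longrightarrow> inv\<^bsub>G'\<^esub> w \<in> image_class (inv z)" by (rule inv_mem)
    show "\<And>z w. z \<in> carrier G \<Longrightarrow> w \<in> carrier G \<Longrightarrow> image_class (z \<otimes> w) \<subseteq> image_class z <#>\<^bsub>G'\<^esub> image_class w"
      by (rule image_class_mult)
    show "{\<one>, x0} \<subseteq> carrier G" using assms(2) by simp
    show "f0 \<in> {\<one>, x0} \<rightarrow> carrier G'" using y0 by (auto simp: f0_def)
    show "\<And>x y. x \<in> {\<one>, x0} \<Longrightarrow> y \<in> {\<one>, x0} \<Longrightarrow> f0 x \<otimes>\<^bsub>G'\<^esub> inv\<^bsub>G'\<^esub> f0 y \<in> image_class (x \<otimes> inv y)"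
      by (rule diff)
    fix f
    assume "f \<in> carrier G \<rightarrow> carrier G'" "\<And>x. x \<in> {\<one>, x0} \<Longrightarrow> f x = f0 x"
      "\<And>x y. x \<in> carrier G \<Longrightarrow> y \<in> carrier G \<Longrightarrow> f x \<otimes>\<^bsub>G'\<^esub> inv\<^bsub>G'\<^esub> f y \<in> image_class (x \<otimes> inv y)"
    then show thesis using that[of f] f0x0 by (simp add: f0_def)
  qed
qed

text \<open>The condition on differences says \<open>f (X y) \<subseteq> X\<^sup>\<phi> f y\<close>. It makes \<open>f\<close> injective, because only the class
  of \<open>1\<close> has \<open>1\<close> in its image; then equal cardinalities give equality, and the equalities with \<open>y = 1\<close>,
  taken over all \<open>X\<close>, make \<open>f\<close> surjective.\<close>

lemma induces_if_differences:
  assumes f: "f \<in> carrier G \<rightarrow> carrier G'"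
    and diff: "\<And>x y. x \<in> carrier G \<Longrightarrow> y \<in> carrier G \<Longrightarrow> f x \<otimes>\<^bsub>G'\<^esub> inv\<^bsub>G'\<^esub> f y \<in> image_class (x \<otimes> inv y)"
  shows "induces G A G' A' f \<phi>"
proof -
  have inj: "inj_on f (carrier G)"
  proof (rule inj_onI)
    fix x y assume xy: "x \<in> carrier G" "y \<in> carrier G" "f x = f y"
    then have "\<one>\<^bsub>G'\<^esub> \<in> image_class (x \<otimes> inv y)"
      using diff[of x y] f by (auto simp: Pi_iff)
    then have "x \<otimes> inv y = \<one>" using image_class_eq_one xy by simp
    then show "x = y" using xy by (metis G.inv_equality G.inv_inv G.inv_closed)
  qed
  have coset_eq: "f ` (X #> y) = image_class z #>\<^bsub>G'\<^esub> f y"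
    if X: "X \<in> basic_sets G A" "z \<in> X" and y: "y \<in> carrier G" for X z y
  proof (rule card_subset_eq)
    have XG: "X \<subseteq> carrier G" using basic_sets_subset[OF S_ring X(1)] .
    have fy: "f y \<in> carrier G'" using f y by auto
    have coset_image: "image_class z #>\<^bsub>G'\<^esub> f y = (\<lambda>w. w \<otimes>\<^bsub>G'\<^esub> f y) ` image_class z"
      by (auto simp: r_coset_def)
    have fin: "finite (image_class z)" using image_class_subset is_group(4) finite_subset by blast
    then show "finite (image_class z #>\<^bsub>G'\<^esub> f y)" unfolding coset_image by simp
    show sub: "f ` (X #> y) \<subseteq> image_class z #>\<^bsub>G'\<^esub> f y"
    proof
      fix v assume "v \<in> f ` (X #> y)"
      then obtain x where x: "x \<in> X" "v = f (x \<otimes> y)" by (auto simp: r_coset_def)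
      have xG: "x \<in> carrier G" using x XG by auto
      obtain X' where X': "X' \<in> basic_sets G' A'" "\<phi> (set_elem X) = set_elem X'"
        using sim X(1) unfolding similarity_def by blast
      have "image_class x = image_class z" using image_class_eq[OF X(1) X'] X(2) x(1) by simp
      moreover have "v \<otimes>\<^bsub>G'\<^esub> inv\<^bsub>G'\<^esub> f y \<in> image_class x"
        using diff[of "x \<otimes> y" y] xG y x(2) by (simp add: G.m_assoc)
      moreover have "v = (v \<otimes>\<^bsub>G'\<^esub> inv\<^bsub>G'\<^esub> f y) \<otimes>\<^bsub>G'\<^esub> f y"
        using x(2) xG y f fy by (simp add: G'.m_assoc Pi_iff)
      ultimately show "v \<in> image_class z #>\<^bsub>G'\<^esub> f y" unfolding coset_image by blast
    qed
    have "card (f ` (X #> y)) = card X"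
    proof -
      have "inj_on (\<lambda>x. x \<otimes> y) X"
        using XG y by (intro inj_onI) (metis G.right_cancel subsetD)
      moreover have "X #> y = (\<lambda>x. x \<otimes> y) ` X" by (auto simp: r_coset_def)
      moreover have "inj_on f (X #> y)"
        using inj by (rule inj_on_subset) (use XG y in \<open>auto simp: r_coset_def\<close>)
      ultimately show ?thesis by (simp add: card_image)
    qed
    then have "card (image_class z #>\<^bsub>G'\<^esub> f y) \<le> card (f ` (X #> y))"
      using card_image_class[OF X] card_image_le[OF fin] unfolding coset_image by simp
    moreover have "card (f ` (X #> y)) \<le> card (image_class z #>\<^bsub>G'\<^esub> f y)"
      using sub fin unfolding coset_image by (intro card_mono) auto
    ultimately show "card (f ` (X #> y)) = card (image_class z #>\<^bsub>G'\<^esub> f y)" by simp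
  qed
  have surj: "carrier G' \<subseteq> f ` carrier G"
  proof
    fix v assume v: "v \<in> carrier G'"
    have f1: "f \<one> \<in> carrier G'" using f by auto
    have "v \<otimes>\<^bsub>G'\<^esub> inv\<^bsub>G'\<^esub> f \<one> \<in> carrier G'" using v f1 by simp
    from image_class_cover[OF this] obtain z
      where z: "z \<in> carrier G" "v \<otimes>\<^bsub>G'\<^esub> inv\<^bsub>G'\<^esub> f \<one> \<in> image_class z" ..
    obtain X where X: "X \<in> basic_sets G A" "z \<in> X" by (rule basic_sets_cover[OF S_ring z(1)])
    have "v = (v \<otimes>\<^bsub>G'\<^esub> inv\<^bsub>G'\<^esub> f \<one>) \<otimes>\<^bsub>G'\<^esub> f \<one>" using v f1 by (simp add: G'.m_assoc)
    then have "v \<in> image_class z #>\<^bsub>G'\<^esub> f \<one>" using z(2) unfolding r_coset_def by blast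
    then have "v \<in> f ` (X #> \<one>)" using coset_eq[OF X] by simp
    then show "v \<in> f ` carrier G"
      using basic_sets_subset[OF S_ring X(1)] by (auto simp: r_coset_def)
  qed
  have "bij_betw f (carrier G) (carrier G')"
    using inj surj f by (auto simp: bij_betw_def)
  moreover have "\<exists>X'\<in>basic_sets G' A'. \<phi> (set_elem X) = set_elem X' \<and>
      (\<forall>y\<in>carrier G. f ` (X #> y) = X' #>\<^bsub>G'\<^esub> f y)" if X: "X \<in> basic_sets G A" for X
  proof -
    obtain z where z: "z \<in> X" using basic_sets_nonempty[OF S_ring X] by blast
    obtain X' where X': "X' \<in> basic_sets G' A'" "\<phi> (set_elem X) = set_elem X'"
      using sim X unfolding similarity_def by blast
    show ?thesis using X' coset_eq[OF X z] image_class_eq[OF X X' z] by blast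
  qed
  ultimately show ?thesis unfolding induces_def by blast
qed

end

lemma coset_S_ring_similarity_induced:
  assumes "coset_S_ring G A" "circulant_S_ring G' A'" "similarity G A G' A' \<phi>"
  shows "\<exists>f. induces G A G' A' f \<phi>"
proof -
  interpret coset_similarity G A G' A' \<phi>
    using assms by unfold_locales (auto simp: coset_S_ring_def circulant_S_ring_def)
  have "cyclic_group G'" using assms(2) by (simp add: circulant_S_ring_def)
  moreover have "\<one>\<^bsub>G'\<^esub> \<in> image_class \<one>\<^bsub>G\<^esub>" by (simp add: image_class_one)
  ultimately obtain f where "f \<in> carrier G \<rightarrow> carrier G'"
    "\<And>x y. x \<in> carrier G \<Longrightarrow> y \<in> carrier G \<Longrightarrow>
      f x \<otimes>\<^bsub>G'\<^esub> inv\<^bsub>G'\<^esub> f y \<in> image_class (x \<otimes>\<^bsub>G\<^esub> inv\<^bsub>G\<^esub> y)"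
    using induced_map_extends[OF _ G.one_closed] by metis
  then show ?thesis using induces_if_differences by blast
qed

section \<open>Schurity and separability\<close>

text \<open>The automorphism group of the association scheme of \<open>A\<close>: the permutations that preserve the class
  of every difference. It is the largest group whose point stabilizer could have the basic sets as
  orbits.\<close>

definition class_automorphisms :: "('a, 'm) monoid_scheme \<Rightarrow> ('a \<Rightarrow> int) set \<Rightarrow> ('a \<Rightarrow> 'a) set" where
  "class_automorphisms G A = {f \<in> Bij (carrier G). \<forall>X\<in>basic_sets G A. \<forall>x\<in>carrier G. \<forall>y\<in>carrier G.
     f x \<otimes>\<^bsub>G\<^esub> inv\<^bsub>G\<^esub> f y \<in> X \<longleftrightarrow> x \<otimes>\<^bsub>G\<^esub> inv\<^bsub>G\<^esub> y \<in> X}"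

lemma subgroup_class_automorphisms:
  "subgroup (class_automorphisms G A) (BijGroup (carrier G))"
proof (rule group.subgroupI[OF group_BijGroup])
  show "class_automorphisms G A \<subseteq> carrier (BijGroup (carrier G))"
    by (auto simp: class_automorphisms_def BijGroup_def)
  have "(\<lambda>x\<in>carrier G. x) \<in> class_automorphisms G A"
    by (auto simp: class_automorphisms_def id_Bij)
  then show "class_automorphisms G A \<noteq> {}" by blast
next
  fix f assume f: "f \<in> class_automorphisms G A"
  then have Bij: "f \<in> Bij (carrier G)" by (simp add: class_automorphisms_def)
  then have "inv_into (carrier G) f x \<in> carrier G \<and> f (inv_into (carrier G) f x) = x"
    if "x \<in> carrier G" for x
    using that by (auto simp: Bij_def bij_betw_def intro: inv_into_into f_inv_into_f)
  then show "inv\<^bsub>BijGroup (carrier G)\<^esub> f \<in> class_automorphisms G A"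
    using f restrict_inv_into_Bij[OF Bij]
    unfolding inv_BijGroup[OF Bij] class_automorphisms_def by simp metis
next
  fix f g assume fg: "f \<in> class_automorphisms G A" "g \<in> class_automorphisms G A"
  then have Bij: "f \<in> Bij (carrier G)" "g \<in> Bij (carrier G)"
    by (auto simp: class_automorphisms_def)
  then have "f \<otimes>\<^bsub>BijGroup (carrier G)\<^esub> g = compose (carrier G) f g" by (simp add: BijGroup_def)
  moreover have "g x \<in> carrier G" if "x \<in> carrier G" for x
    using Bij_imp_funcset[OF Bij(2)] that by auto
  ultimately show "f \<otimes>\<^bsub>BijGroup (carrier G)\<^esub> g \<in> class_automorphisms G A"
    using fg compose_Bij[OF Bij] by (simp add: class_automorphisms_def compose_eq)
qed

lemma right_mults_class_automorphisms:
  assumes "group G"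
  shows "right_mults G \<subseteq> class_automorphisms G A"
proof
  interpret group G by fact
  fix f assume "f \<in> right_mults G"
  then obtain g where g: "g \<in> carrier G" and f: "f = (\<lambda>x\<in>carrier G. x \<otimes>\<^bsub>G\<^esub> g)"
    by (auto simp: right_mults_def)
  have "bij_betw f (carrier G) (carrier G)"
    by (rule bij_betw_byWitness[where f' = "\<lambda>x. x \<otimes>\<^bsub>G\<^esub> inv\<^bsub>G\<^esub> g"])
      (use g in \<open>auto simp: f m_assoc\<close>)
  then have "f \<in> Bij (carrier G)" by (simp add: Bij_def f)
  moreover have "f x \<otimes>\<^bsub>G\<^esub> inv\<^bsub>G\<^esub> f y = x \<otimes>\<^bsub>G\<^esub> inv\<^bsub>G\<^esub> y"
    if "x \<in> carrier G" "y \<in> carrier G" for x y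
    using that g mult_inv_mult_cancel[of x "inv\<^bsub>G\<^esub> g" "inv\<^bsub>G\<^esub> y"] by (simp add: f inv_mult_group)
  ultimately show "f \<in> class_automorphisms G A" by (simp add: class_automorphisms_def)
qed

text \<open>For the identity similarity the image class of \<open>x\<close> is its own basic set, so a map inducing it and
  taking \<open>x\<close> to \<open>y\<close> exists.\<close>

lemma coset_S_ring_automorphism:
  assumes "coset_S_ring G A" "cyclic_group G" "X \<in> basic_sets G A" "x \<in> X" "y \<in> X"
  shows "\<exists>f\<in>class_automorphisms G A. f \<one>\<^bsub>G\<^esub> = \<one>\<^bsub>G\<^esub> \<and> f x = y"
proof -
  have S: "S_ring G A" using assms(1) by (simp add: coset_S_ring_def)
  have "similarity G A G A (\<lambda>a. a)"
    by (auto simp: similarity_def ring_iso_def ring_hom_def bij_betw_def)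
  then interpret coset_similarity G A G A "\<lambda>a. a"
    using assms(1) by unfold_locales (auto simp: coset_S_ring_def)
  have img: "image_class z = Z" if "Z \<in> basic_sets G A" "z \<in> Z" for z Z
    using image_class_eq[OF that(1,1) refl that(2)] .
  have xG: "x \<in> carrier G" using assms basic_sets_subset[OF S] by blast
  have "y \<in> image_class x" using img[OF assms(3,4)] assms(5) by simp
  from induced_map_extends[OF assms(2) xG this]
  obtain f where f: "f \<in> carrier G \<rightarrow> carrier G" "f \<one>\<^bsub>G\<^esub> = \<one>\<^bsub>G\<^esub>" "f x = y"
    and diff: "\<And>s t. s \<in> carrier G \<Longrightarrow> t \<in> carrier G \<Longrightarrow>
      f s \<otimes>\<^bsub>G\<^esub> inv\<^bsub>G\<^esub> f t \<in> image_class (s \<otimes>\<^bsub>G\<^esub> inv\<^bsub>G\<^esub> t)"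
    by metis
  have "bij_betw f (carrier G) (carrier G)"
    using induces_if_differences[OF f(1) diff] by (simp add: induces_def)
  then have "bij_betw (restrict f (carrier G)) (carrier G) (carrier G)"
    by (simp cong: bij_betw_cong)
  then have Bij: "restrict f (carrier G) \<in> Bij (carrier G)" by (simp add: Bij_def)
  have "f s \<otimes>\<^bsub>G\<^esub> inv\<^bsub>G\<^esub> f t \<in> Z \<longleftrightarrow> s \<otimes>\<^bsub>G\<^esub> inv\<^bsub>G\<^esub> t \<in> Z"
    if Z: "Z \<in> basic_sets G A" and st: "s \<in> carrier G" "t \<in> carrier G" for Z s t
  proof -
    have "s \<otimes>\<^bsub>G\<^esub> inv\<^bsub>G\<^esub> t \<in> carrier G" using st by simp
    then obtain Y where Y: "Y \<in> basic_sets G A" "s \<otimes>\<^bsub>G\<^esub> inv\<^bsub>G\<^esub> t \<in> Y"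
      by (rule basic_sets_cover[OF S])
    have "f s \<otimes>\<^bsub>G\<^esub> inv\<^bsub>G\<^esub> f t \<in> Y" using diff[OF st] img[OF Y] by simp
    then show ?thesis using basic_sets_eq[OF S Z Y(1)] Y(2) by blast
  qed
  then have "restrict f (carrier G) \<in> class_automorphisms G A"
    using Bij by (simp add: class_automorphisms_def)
  then show ?thesis using f(2,3) xG by (intro bexI[of _ "restrict f (carrier G)"]) auto
qed

lemma coset_S_ring_schurian:
  assumes "coset_S_ring G A" "cyclic_group G"
  shows "schurian G A"
proof -
  have S: "S_ring G A" and G: "group G" using assms(1) by (auto simp: coset_S_ring_def S_ring_def)
  interpret group G by fact
  let ?St = "{f \<in> class_automorphisms G A. f \<one>\<^bsub>G\<^esub> = \<one>\<^bsub>G\<^esub>}"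
  have orbit: "{f x | f. f \<in> ?St} = X" if X: "X \<in> basic_sets G A" "x \<in> X" for X x
  proof
    have x: "x \<in> carrier G" using X basic_sets_subset[OF S] by blast
    show "{f x | f. f \<in> ?St} \<subseteq> X"
    proof clarify
      fix f assume f: "f \<in> class_automorphisms G A" "f \<one>\<^bsub>G\<^esub> = \<one>\<^bsub>G\<^esub>"
      then have "f x \<in> carrier G"
        using x by (auto simp: class_automorphisms_def dest: Bij_imp_funcset)
      moreover have "f x \<otimes>\<^bsub>G\<^esub> inv\<^bsub>G\<^esub> f \<one>\<^bsub>G\<^esub> \<in> X \<longleftrightarrow> x \<otimes>\<^bsub>G\<^esub> inv\<^bsub>G\<^esub> \<one>\<^bsub>G\<^esub> \<in> X"
        using f(1) X(1) x by (simp add: class_automorphisms_def)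
      ultimately show "f x \<in> X" using f(2) X(2) x by simp
    qed
    show "X \<subseteq> {f x | f. f \<in> ?St}"
      using coset_S_ring_automorphism[OF assms X] by blast
  qed
  have "basic_sets G A = {{f x | f. f \<in> ?St} | x. x \<in> carrier G}"
  proof (intro equalityI subsetI)
    fix X assume X: "X \<in> basic_sets G A"
    then obtain x where "x \<in> X" using basic_sets_nonempty[OF S] by blast
    then show "X \<in> {{f x | f. f \<in> ?St} | x. x \<in> carrier G}"
      using orbit[OF X] basic_sets_subset[OF S X] by blast
  next
    fix X assume "X \<in> {{f x | f. f \<in> ?St} | x. x \<in> carrier G}"
    then obtain x where x: "x \<in> carrier G" "X = {f x | f. f \<in> ?St}" by blast
    obtain Y where "Y \<in> basic_sets G A" "x \<in> Y" by (rule basic_sets_cover[OF S x(1)])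
    then show "X \<in> basic_sets G A" using orbit x(2) by simp
  qed
  then show ?thesis
    unfolding schurian_def Let_def orbits_def orbit_def stabilizer_def
    using subgroup_class_automorphisms[of G A] right_mults_class_automorphisms[OF G, of A]
    by (intro exI[of _ "class_automorphisms G A"]) simp
qed

theorem theorem9p1:
  fixes G :: "('a, 'm) monoid_scheme" and A :: "('a \<Rightarrow> int) set"
  assumes "group G" and "finite (carrier G)" and "cyclic_group G"
    and "coset_S_ring G A"
  shows "schurian G A \<and> separable TYPE('b) G A"
proof
  show "schurian G A" using assms by (simp add: coset_S_ring_schurian)
  have "circulant_S_ring G A"
    using assms by (simp add: circulant_S_ring_def coset_S_ring_def)
  then show "separable TYPE('b) G A"
    using coset_S_ring_similarity_induced[OF assms(4)] by (auto simp: separable_def)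
qed

end
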